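(* Assume the setting in the context, and let $\mathbf d^*$ be any $\Phi_{\mathfrak B}$-optimal design with $\boldsymbol\Sigma^*=\mathbf M(\mathbf d^* )^{-1}=(c^*_{jk})$. Then for all $j,k\in\{1,\dots,m\}$: $$|c^*_{jk}|\le \alpha K\big[(\mathbf B\mathbf B')^{-1}_{jj}(\mathbf B\mathbf B')^{-1}_{kk}\big]^{1/2},$$ $$|c^*_{jk}|\le \alpha\big[\mathbf N^+_{jj}(\mathbf w^{(j+)})\,\mathbf N^+_{kk}(\mathbf w^{(k+)})\big]^{1/2},$$ $$|c^*_{jk}|\le \alpha\big[\mathbf N^+_{jj}(\mathbf w^{(j* )})\,\mathbf N^+_{kk}(\mathbf w^{(k* )})\big]^{1/2},$$ where $\mathbf A_{ij}$ denotes the $(i,j)$ entry of a matrix $\mathbf A$.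
   Context: Let $n,m,N,K$ be positive integers with $2\le m\le N\le n$, and let $\mathbf f_1,\dots,\mathbf f_n\in\mathbb R^m$ span $\mathbb R^m$. A (binary) design is $\mathbf d\in\{0,1\}^n$ with $\sum_i d_i=N$; its information matrix is $\mathbf M(\mathbf d)=\sum_{i=1}^n d_i\mathbf f_i\mathbf f_i'$. For $\ell\in\{1,\dots,K\}$ let $\mathbf B_\ell$ be a real $m\times s_\ell$ matrix, $\mathbf B=(\mathbf B_1,\dots,\mathbf B_K)$, with column space of $\mathbf B$ equal to $\mathbb R^m$ and no zero column. For positive definite $\mathbf M$, $\Phi_{\mathfrak B}(\mathbf M)=\max_{\ell}\mathrm{tr}(\mathbf B_\ell'\mathbf M^{-1}\mathbf B_\ell)$. A $\Phi_{\mathfrak B}$-optimal design minimizes $\Phi_{\mathfrak B}(\mathbf M(\mathbf d))$ over designs $\mathbf d$ with nonsingular $\mathbf M(\mathbf d)$. Let $\mathbf d_0$ be a design with nonsingular $\mathbf M(\mathbf d_0)$ and $\alpha=\Phi_{\mathfrak B}(\mathbf M(\mathbf d_0))$. For $\mathbf w\in\mathbb R^K$, $\mathbf w\ge 0$, $\sum w_\ell=1$, let $\mathbf N(\mathbf w)=\sum_\ell w_\ell\mathbf B_\ell\mathbf B_\ell'$; $\mathbf A^+$ is the Moore–Penrose pseudoinverse and $\mathbf e_j$ the $j$-th unit vector. For $j\in\{1,\dots,m\}$: write $\mathbf B^+\mathbf e_j=((\mathbf h^{(j+)}_1)',\dots,(\mathbf h^{(j+)}_K)')'$ with $\mathbf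 h^{(j+)}_\ell\in\mathbb R^{s_\ell}$, and set $w^{(j+)}_\ell=\|\mathbf h^{(j+)}_\ell\|/\sum_{t}\|\mathbf h^{(j+)}_t\|$; $\mathbf w^{(j* )}$ is a minimizer of $\mathbf e_j'\mathbf N^+(\mathbf w)\mathbf e_j$ over all such $\mathbf w$ with $\mathbf e_j\in\mathcal C(\mathbf N(\mathbf w))$. *)

theory Defs
  imports "HOL-Analysis.Analysis"
begin

text \<open>Setting. The support points f_1..f_n are indexed by a finite type 'n,
  the ambient space R^m is real^'m. The concatenated matrix B = (B_1,...,B_K)
  is an m x S matrix with columns indexed by a finite type 'c; the map
  blk :: 'c => 'k assigns each column to its block (the blocks are the types 'k,
  K = CARD('k)); B_l consists of the columns c with blk c = l.\<close>

definition outer :: "real^'m \<Rightarrow> real^'m \<Rightarrow> real^'m^'m" where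
  "outer x y = (\<chi> i j. x $ i * y $ j)"

text \<open>Binary designs: d \<in> {0,1}^n with sum d = N, represented by the support set.\<close>
definition is_design :: "nat \<Rightarrow> ('n::finite \<Rightarrow> bool) \<Rightarrow> bool" where
  "is_design N d \<longleftrightarrow> card {i. d i} = N"

definition info_mat :: "('n::finite \<Rightarrow> real^'m) \<Rightarrow> ('n \<Rightarrow> bool) \<Rightarrow> real^'m^'m" where
  "info_mat f d = (\<Sum>i\<in>{i. d i}. outer (f i) (f i))"

text \<open>Moore-Penrose pseudoinverse: the unique matrix satisfying the Penrose equations.\<close>
definition pinv :: "real^'b^'a \<Rightarrow> real^'a^'b" where
  "pinv A = (THE X. A ** X ** A = A \<and> X ** A ** X = X \<and>
                   transpose (A ** X) = A ** X \<and> transpose (X ** A) = X ** A)"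

text \<open>tr(B_l' M^{-1} B_l) = sum over columns b of B_l of b' M^{-1} b.\<close>
definition block_trace :: "real^'c^'m \<Rightarrow> ('c::finite \<Rightarrow> 'k) \<Rightarrow> 'k \<Rightarrow> real^'m^'m \<Rightarrow> real" where
  "block_trace B blk l M = (\<Sum>c\<in>{c. blk c = l}. column c B \<bullet> (matrix_inv M *v column c B))"

definition Phi :: "real^'c^'m \<Rightarrow> ('c::finite \<Rightarrow> 'k::finite) \<Rightarrow> real^'m^'m \<Rightarrow> real" where
  "Phi B blk M = Max ((\<lambda>l. block_trace B blk l M) ` UNIV)"

definition Phi_optimal :: "real^'c^'m \<Rightarrow> ('c::finite \<Rightarrow> 'k::finite) \<Rightarrow> ('n::finite \<Rightarrow> real^'m)
     \<Rightarrow> nat \<Rightarrow> ('n \<Rightarrow> bool) \<Rightarrow> bool" where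
  "Phi_optimal B blk f N d \<longleftrightarrow> is_design N d \<and> invertible (info_mat f d) \<and>
     (\<forall>d'. is_design N d' \<and> invertible (info_mat f d') \<longrightarrow>
        Phi B blk (info_mat f d) \<le> Phi B blk (info_mat f d'))"

definition weight :: "('k::finite \<Rightarrow> real) \<Rightarrow> bool" where
  "weight w \<longleftrightarrow> (\<forall>l. w l \<ge> 0) \<and> sum w UNIV = 1"

text \<open>N(w) = sum_l w_l B_l B_l'.\<close>
definition Nmat :: "real^'c^'m \<Rightarrow> ('c::finite \<Rightarrow> 'k::finite) \<Rightarrow> ('k \<Rightarrow> real) \<Rightarrow> real^'m^'m" where
  "Nmat B blk w = (\<Sum>l\<in>UNIV. w l *\<^sub>R (\<Sum>c\<in>{c. blk c = l}. outer (column c B) (column c B)))"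

text \<open>||h_l^{(j+)}|| where B^+ e_j = (h_1', ..., h_K')'.\<close>
definition hnorm :: "real^'c^'m \<Rightarrow> ('c::finite \<Rightarrow> 'k) \<Rightarrow> 'm \<Rightarrow> 'k \<Rightarrow> real" where
  "hnorm B blk j l = sqrt (\<Sum>c\<in>{c. blk c = l}. ((pinv B *v axis j 1) $ c)\<^sup>2)"

definition w_plus :: "real^'c^'m \<Rightarrow> ('c::finite \<Rightarrow> 'k::finite) \<Rightarrow> 'm \<Rightarrow> 'k \<Rightarrow> real" where
  "w_plus B blk j l = hnorm B blk j l / (\<Sum>t\<in>UNIV. hnorm B blk j t)"

text \<open>w is a minimizer of e_j' N^+(w) e_j over weights w with e_j in the column space of N(w).\<close>
definition is_w_star :: "real^'c^'m \<Rightarrow> ('c::finite \<Rightarrow> 'k::finite) \<Rightarrow> 'm \<Rightarrow> ('k \<Rightarrow> real) \<Rightarrow> bool" where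
  "is_w_star B blk j w \<longleftrightarrow> weight w \<and> axis j 1 \<in> range ((*v) (Nmat B blk w)) \<and>
     (\<forall>w'. weight w' \<and> axis j 1 \<in> range ((*v) (Nmat B blk w')) \<longrightarrow>
        axis j 1 \<bullet> (pinv (Nmat B blk w) *v axis j 1) \<le> axis j 1 \<bullet> (pinv (Nmat B blk w') *v axis j 1))"

end

theory Submission
  imports Defs
begin

text \<open>Let S = M(d*)^-1. Optimality of d* against d0 bounds every block trace
  tr(B_l' S B_l) by \<alpha>. For a weight w and a vector e = N(w) x in the range of N(w),
  both e' S e and e' N(w)^- e are weighted sums over the columns of B, and two applications of
  Cauchy-Schwarz give e' S e \<le> \<alpha> e' N(w)^- e for every generalized inverse N(w)^-. Taking
  e = e_j yields bounds on the diagonal entries of S for the uniform weight (where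
  N = BB'/K), for w^(j+) (whose support covers that of B^+ e_j, so that e_j lies in the range of
  N(w^(j+))) and for w^(j*). The off-diagonal entries follow from |s_jk| \<le> sqrt(s_jj s_kk).\<close>

definition penrose :: "real^'b^'a \<Rightarrow> real^'a^'b \<Rightarrow> bool" where
  "penrose A X \<longleftrightarrow> A ** X ** A = A \<and> X ** A ** X = X \<and>
                   transpose (A ** X) = A ** X \<and> transpose (X ** A) = X ** A"

lemma symmetric_matrix_inner_commute:
  fixes A :: "real^'m^'m"
  assumes "transpose A = A" shows "(A *v u) \<bullet> v = u \<bullet> (A *v v)"
  by (metis assms dot_lmul_matrix transpose_matrix_vector)

lemma symmetric_matrixI:
  fixes A :: "real^'m^'m"
  assumes "\<And>u v. (A *v u) \<bullet> v = u \<bullet> (A *v v)" shows "transpose A = A"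
proof -
  have "(transpose A *v u) \<bullet> v = (A *v u) \<bullet> v" for u v
    by (simp add: dot_lmul_matrix assms)
  then have "transpose A *v u = A *v u" for u
    by (metis vector_eq_rdot)
  then show ?thesis
    by (simp add: matrix_eq)
qed

lemma outer_mult_vector: "outer x y *v v = (y \<bullet> v) *\<^sub>R x"
  by (simp add: outer_def matrix_vector_mult_def vec_eq_iff inner_vec_def sum_distrib_left
      mult.assoc mult.commute mult.left_commute)

lemma sum_matrix_vector: "sum A S *v v = (\<Sum>l\<in>S. A l *v v)"
  by (induct S rule: infinite_finite_induct) (auto simp: matrix_vector_mult_add_rdistrib)

lemma orthogonal_projection_matrix_exists:
  fixes S :: "(real^'m) set"
  assumes "subspace S"
  obtains Q :: "real^'m^'m"
  where "transpose Q = Q" "\<And>x. Q *v x \<in> S" "\<And>x s. s \<in> S \<Longrightarrow> (x - Q *v x) \<bullet> s = 0"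
proof -
  obtain Bs where Bs: "Bs \<subseteq> S" "pairwise orthogonal Bs" "\<And>b. b \<in> Bs \<Longrightarrow> norm b = 1"
    "independent Bs" "span Bs = S"
    using orthonormal_basis_subspace[OF assms] by metis
  have fin: "finite Bs" using Bs(4) by (rule finiteI_independent)
  have orthonormal: "b \<bullet> b' = (if b = b' then 1 else 0)" if "b \<in> Bs" "b' \<in> Bs" for b b'
    using that Bs(2,3) norm_eq_1 by (auto simp: pairwise_def orthogonal_def)
  define Q where "Q = (\<Sum>b\<in>Bs. outer b b)"
  have Q: "Q *v x = (\<Sum>b\<in>Bs. (b \<bullet> x) *\<^sub>R b)" for x
    by (simp add: Q_def sum_matrix_vector outer_mult_vector)
  show thesis
  proof
    show "transpose Q = Q"
      by (rule symmetric_matrixI) (simp add: Q inner_sum_left inner_sum_right inner_commute mult.commute)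
    show "Q *v x \<in> S" for x
    proof -
      have "Q *v x \<in> span Bs" unfolding Q by (intro span_sum span_scale span_base)
      then show ?thesis using Bs(5) by simp
    qed
    show "(x - Q *v x) \<bullet> s = 0" if "s \<in> S" for x s
    proof -
      have "orthogonal (x - Q *v x) b" if "b \<in> Bs" for b
      proof -
        have "(Q *v x) \<bullet> b = (\<Sum>b'\<in>Bs. (b' \<bullet> x) * (b' \<bullet> b))"
          by (simp add: Q inner_sum_left)
        also have "\<dots> = (\<Sum>b'\<in>Bs. if b' = b then b \<bullet> x else 0)"
          using orthonormal that by (intro sum.cong) auto
        also have "\<dots> = x \<bullet> b"
          using fin that by (simp add: inner_commute)
        finally show ?thesis
          by (simp add: orthogonal_def inner_diff_left)
      qed
      then show ?thesis
        using orthogonal_to_span[of s Bs] \<open>s \<in> S\<close> Bs(5) by (simp add: orthogonal_def)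
    qed
  qed
qed

lemma penrose_unique:
  assumes X: "penrose A X" and Y: "penrose A Y" shows "X = Y"
proof -
  have x1: "A ** X ** A = A" and x2: "X ** A ** X = X" and x3: "transpose (A ** X) = A ** X"
    and x4: "transpose (X ** A) = X ** A" using X unfolding penrose_def by auto
  have y1: "A ** Y ** A = A" and y2: "Y ** A ** Y = Y" and y3: "transpose (A ** Y) = A ** Y"
    and y4: "transpose (Y ** A) = Y ** A" using Y unfolding penrose_def by auto
  have "X = X ** (A ** X)" using x2 by (simp add: matrix_mul_assoc)
  also have "\<dots> = X ** transpose (A ** X)" using x3 by simp
  also have "\<dots> = X ** transpose X ** transpose A" by (simp add: matrix_transpose_mul matrix_mul_assoc)
  also have "\<dots> = X ** transpose X ** transpose (A ** Y ** A)" using y1 by simp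
  also have "\<dots> = X ** transpose X ** transpose A ** transpose (A ** Y)"
    by (simp add: matrix_transpose_mul matrix_mul_assoc)
  also have "\<dots> = X ** transpose (A ** X) ** (A ** Y)" using y3
    by (simp add: matrix_transpose_mul matrix_mul_assoc)
  also have "\<dots> = X ** A ** Y" using x3 x2 by (simp add: matrix_mul_assoc)
  finally have 1: "X = X ** A ** Y" .
  have "Y = (Y ** A) ** Y" using y2 by (simp add: matrix_mul_assoc)
  also have "\<dots> = transpose (Y ** A) ** Y" using y4 by simp
  also have "\<dots> = transpose A ** transpose Y ** Y" by (simp add: matrix_transpose_mul matrix_mul_assoc)
  also have "\<dots> = transpose (A ** X ** A) ** transpose Y ** Y" using x1 by simp
  also have "\<dots> = transpose (X ** A) ** transpose A ** transpose Y ** Y"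
    by (simp add: matrix_transpose_mul matrix_mul_assoc)
  also have "\<dots> = (X ** A) ** transpose (Y ** A) ** Y" using x4
    by (simp add: matrix_transpose_mul matrix_mul_assoc)
  also have "\<dots> = X ** A ** (Y ** A ** Y)" using y4 by (simp add: matrix_mul_assoc)
  also have "\<dots> = X ** A ** Y" using y2 by simp
  finally show ?thesis using 1 by simp
qed

lemma pinv_eqI:
  assumes "penrose A X" shows "pinv A = X"
proof -
  have "(THE X. penrose A X) = X"
    using assms penrose_unique by (intro the_equality) auto
  then show ?thesis
    by (simp add: pinv_def penrose_def)
qed

lemma matrix_inv_mult:
  fixes M :: "real^'m^'m"
  assumes "invertible M"
  shows "M ** matrix_inv M = mat 1" "matrix_inv M ** M = mat 1"
  using someI_ex[OF assms[unfolded invertible_def]] unfolding matrix_inv_def by auto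

lemma invertible_if_inj:
  fixes A :: "real^'m^'m"
  assumes "\<And>x. A *v x = 0 \<Longrightarrow> x = 0" shows "invertible A"
proof -
  have "inj ((*v) A)"
    by (rule injI) (metis assms eq_iff_diff_eq_0 matrix_vector_mult_diff_distrib)
  then show ?thesis
    using matrix_left_invertible_injective invertible_left_inverse by blast
qed

text \<open>The hypotheses say that Q is the orthogonal projection onto the kernel of N.\<close>
lemma penrose_kernel_projection:
  fixes N Q :: "real^'m^'m"
  assumes symQ: "transpose Q = Q" and QQ: "Q ** Q = Q" and NQ: "N ** Q = 0" and QN: "Q ** N = 0"
    and inv: "invertible (N + Q)"
  shows "penrose N (matrix_inv (N + Q) - Q)"
proof -
  define A X where "A = N + Q" and "X = matrix_inv (N + Q) - Q"
  have vec: "N *v (Q *v x) = 0" "Q *v (N *v x) = 0" "Q *v (Q *v x) = Q *v x" "A *v x = N *v x + Q *v x"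
    for x using NQ QN QQ by (simp_all add: A_def matrix_vector_mul_assoc matrix_vector_mult_add_rdistrib)
  have A_Ai: "A *v (matrix_inv A *v x) = x" and Ai_A: "matrix_inv A *v (A *v x) = x" for x
    using matrix_inv_mult[OF inv] by (simp_all add: A_def matrix_vector_mul_assoc)
  have Ai_Q: "matrix_inv A *v (Q *v x) = Q *v x" for x
    using Ai_A[of "Q *v x"] by (simp add: vec)
  have Q_Ai: "Q *v (matrix_inv A *v x) = Q *v x" for x
    using arg_cong[OF A_Ai[of x], of "(*v) Q"] by (simp add: vec matrix_vector_right_distrib)
  have X: "X *v x = matrix_inv A *v x - Q *v x" for x
    by (simp add: X_def A_def matrix_vector_mult_diff_rdistrib)
  have NX: "N *v (X *v x) = x - Q *v x" for x
    using A_Ai[of x] by (simp add: X vec Q_Ai matrix_vector_mult_diff_distrib eq_diff_eq)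
  have XN: "X *v (N *v x) = x - Q *v x" for x
    using Ai_A[of x] by (simp add: X vec Ai_Q matrix_vector_right_distrib eq_diff_eq)
  have XQ: "X *v (Q *v x) = 0" and QX: "Q *v (X *v x) = 0" for x
    by (simp_all add: X vec Ai_Q Q_Ai matrix_vector_mult_diff_distrib)
  have sym_I_Q: "(u - Q *v u) \<bullet> v = u \<bullet> (v - Q *v v)" for u v
    using symmetric_matrix_inner_commute[OF symQ] by (simp add: inner_diff_left inner_diff_right)
  have "penrose N X"
    unfolding penrose_def
  proof (intro conjI)
    show "N ** X ** N = N" "X ** N ** X = X"
      by (simp_all add: matrix_eq XN vec XQ QX matrix_vector_mult_diff_distrib flip: matrix_vector_mul_assoc)
    show "transpose (N ** X) = N ** X" "transpose (X ** N) = X ** N"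
      by (rule symmetric_matrixI; simp add: NX XN sym_I_Q flip: matrix_vector_mul_assoc)+
  qed
  then show ?thesis
    by (simp add: X_def)
qed

lemma kernel_projection_exists:
  fixes N :: "real^'m^'m"
  assumes symN: "transpose N = N"
  obtains Q where "transpose Q = Q" "Q ** Q = Q" "N ** Q = 0" "Q ** N = 0" "invertible (N + Q)"
proof -
  define K where "K = {x. N *v x = 0}"
  have "subspace K"
    by (auto simp: subspace_def K_def matrix_vector_right_distrib matrix_vector_mult_scaleR)
  then obtain Q where symQ: "transpose Q = Q" and QK: "\<And>x. Q *v x \<in> K"
    and orth: "\<And>x k. k \<in> K \<Longrightarrow> (x - Q *v x) \<bullet> k = 0"
    using orthogonal_projection_matrix_exists by blast
  have NQ: "N *v (Q *v x) = 0" for x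
    using QK unfolding K_def by simp
  have Q_id: "Q *v k = k" if "k \<in> K" for k
  proof -
    have "(k - Q *v k) \<bullet> (k - Q *v k) = 0"
      by (simp add: inner_diff_right orth that QK)
    then show ?thesis by simp
  qed
  have QN: "Q *v (N *v x) = 0" for x
  proof -
    have "(N *v x) \<bullet> (Q *v (N *v x)) = 0"
      using symmetric_matrix_inner_commute[OF symN, of x "Q *v (N *v x)"] by (simp add: NQ)
    moreover have "(N *v x - Q *v (N *v x)) \<bullet> (Q *v (N *v x)) = 0"
      by (simp add: orth QK)
    ultimately have "(Q *v (N *v x)) \<bullet> (Q *v (N *v x)) = 0"
      by (simp add: inner_diff_left)
    then show ?thesis by simp
  qed
  have "invertible (N + Q)"
  proof (rule invertible_if_inj)
    fix x assume x: "(N + Q) *v x = 0"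
    then have Nx: "N *v x = - (Q *v x)"
      by (simp add: matrix_vector_mult_add_rdistrib eq_neg_iff_add_eq_0)
    have "N *v (N *v x) = N *v ((N + Q) *v x) - N *v (Q *v x)"
      by (simp add: matrix_vector_mult_add_rdistrib matrix_vector_right_distrib)
    also have "\<dots> = 0" by (simp add: x NQ)
    finally have "(N *v x) \<bullet> (N *v x) = 0"
      using symmetric_matrix_inner_commute[OF symN, of x "N *v x"] by simp
    then have "x \<in> K" by (simp add: K_def)
    then show "x = 0" using Nx Q_id by (simp add: K_def)
  qed
  moreover have "Q ** Q = Q" "N ** Q = 0" "Q ** N = 0"
    by (simp_all add: matrix_eq NQ QN Q_id[OF QK] flip: matrix_vector_mul_assoc)
  ultimately show thesis
    using symQ that by blast
qed

lemma penrose_pinv_symmetric: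
  fixes N :: "real^'m^'m"
  assumes "transpose N = N" shows "penrose N (pinv N)"
proof -
  obtain Q where "transpose Q = Q" "Q ** Q = Q" "N ** Q = 0" "Q ** N = 0" "invertible (N + Q)"
    using kernel_projection_exists[OF assms] by blast
  then have "penrose N (matrix_inv (N + Q) - Q)"
    by (rule penrose_kernel_projection)
  then show ?thesis
    by (simp add: pinv_eqI)
qed

lemma in_range_symmetric_matrixI:
  fixes N :: "real^'m^'m"
  assumes symN: "transpose N = N" and ker: "\<And>z. N *v z = 0 \<Longrightarrow> e \<bullet> z = 0"
  shows "e \<in> range ((*v) N)"
proof -
  have "(*v) N -` {0} = (range ((*v) N))\<^sup>\<bottom>"
    using ker_orthogonal_comp_adjoint[OF matrix_vector_mul_linear[of N]] symN
    by (simp add: adjoint_matrix)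
  then have "e \<in> (range ((*v) N))\<^sup>\<bottom>\<^sup>\<bottom>"
    using ker by (auto simp: orthogonal_comp_def orthogonal_def inner_commute)
  then show ?thesis
    using orthogonal_comp_self[OF linear_subspace_image[OF matrix_vector_mul_linear[of N] subspace_UNIV]]
    by simp
qed

definition pos_semidef :: "real^'m^'m \<Rightarrow> bool" where
  "pos_semidef S \<longleftrightarrow> transpose S = S \<and> (\<forall>u. 0 \<le> u \<bullet> (S *v u))"

lemma pos_semidef_inner_square_le:
  fixes S :: "real^'m^'m"
  assumes "pos_semidef S"
  shows "(u \<bullet> (S *v v))\<^sup>2 \<le> (u \<bullet> (S *v u)) * (v \<bullet> (S *v v))"
proof -
  define a b c where "a = u \<bullet> (S *v u)" and "b = v \<bullet> (S *v v)" and "c = u \<bullet> (S *v v)"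
  have psd: "0 \<le> y \<bullet> (S *v y)" for y
    using assms by (simp add: pos_semidef_def)
  have "v \<bullet> (S *v u) = c"
    using assms symmetric_matrix_inner_commute[of S v u] by (simp add: pos_semidef_def c_def inner_commute)
  then have q: "0 \<le> a - 2 * t * c + t\<^sup>2 * b" for t
    using psd[of "u - t *\<^sub>R v"]
    by (simp add: a_def b_def c_def matrix_vector_mult_diff_distrib inner_diff_left inner_diff_right
        algebra_simps power2_eq_square flip: scaleR_matrix_vector_assoc)
  show ?thesis
  proof (cases "b = 0")
    case True
    have "c = 0"
    proof (rule ccontr)
      assume "c \<noteq> 0"
      then have "a - 2 * ((a + 1) / (2 * c)) * c = -1" by (simp add: field_simps)
      with q[of "(a + 1) / (2 * c)"] True show False by simp
    qed
    then show ?thesis using True by (simp flip: a_def b_def c_def)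
  next
    case False
    then have "b > 0" using psd[of v] by (simp add: b_def)
    have "a - 2 * (c / b) * c + (c / b)\<^sup>2 * b = a - c\<^sup>2 / b"
      using \<open>b > 0\<close> by (simp add: field_simps power2_eq_square)
    then have "c\<^sup>2 / b \<le> a"
      using q[of "c / b"] by simp
    then have "c\<^sup>2 \<le> a * b"
      using \<open>b > 0\<close> by (simp add: pos_divide_le_eq)
    then show ?thesis by (simp flip: a_def b_def c_def)
  qed
qed

lemma inner_axis_mult_axis: "axis j 1 \<bullet> ((A::real^'m^'m) *v axis k 1) = A $ j $ k"
  by (simp add: inner_axis' matrix_vector_mult_basis column_def)

lemma pos_semidef_entry_abs_le:
  fixes S :: "real^'m^'m"
  assumes "pos_semidef S" "0 \<le> \<alpha>" "S $ j $ j \<le> \<alpha> * p" "S $ k $ k \<le> \<alpha> * q"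
  shows "\<bar>S $ j $ k\<bar> \<le> \<alpha> * sqrt (p * q)"
proof -
  have diag_nonneg: "0 \<le> S $ i $ i" for i
    using assms(1) unfolding pos_semidef_def by (metis inner_axis_mult_axis)
  have "(S $ j $ k)\<^sup>2 \<le> S $ j $ j * S $ k $ k"
    using pos_semidef_inner_square_le[OF assms(1), of "axis j 1" "axis k 1"]
    by (simp add: inner_axis_mult_axis)
  also have "\<dots> \<le> (\<alpha> * p) * (\<alpha> * q)"
    using assms(3,4) diag_nonneg[of j] diag_nonneg[of k] by (intro mult_mono) linarith+
  also have "\<dots> = \<alpha>\<^sup>2 * (p * q)"
    by (simp add: power2_eq_square)
  finally have "sqrt ((S $ j $ k)\<^sup>2) \<le> sqrt (\<alpha>\<^sup>2 * (p * q))"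
    by (rule real_sqrt_le_mono)
  then show ?thesis
    using assms(2) by (simp add: real_sqrt_mult)
qed

lemma pos_semidef_info_mat: "pos_semidef (info_mat f d)"
proof -
  have info: "info_mat f d *v v = (\<Sum>i\<in>{i. d i}. (f i \<bullet> v) *\<^sub>R f i)" for v
    by (simp add: info_mat_def sum_matrix_vector outer_mult_vector)
  show ?thesis
    unfolding pos_semidef_def
    by (auto intro!: symmetric_matrixI sum_nonneg
        simp: info inner_sum_left inner_sum_right inner_commute mult.commute)
qed

lemma symmetric_matrix_inv:
  fixes M :: "real^'m^'m"
  assumes "invertible M" "transpose M = M"
  shows "transpose (matrix_inv M) = matrix_inv M"
proof (rule symmetric_matrixI)
  fix u v
  have MH: "M *v (matrix_inv M *v y) = y" for y
    using matrix_inv_mult(1)[OF assms(1)] by (simp add: matrix_vector_mul_assoc)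
  have "(matrix_inv M *v u) \<bullet> v = (M *v (matrix_inv M *v u)) \<bullet> (matrix_inv M *v v)"
    using symmetric_matrix_inner_commute[OF assms(2)] by (metis MH)
  then show "(matrix_inv M *v u) \<bullet> v = u \<bullet> (matrix_inv M *v v)"
    by (simp add: MH)
qed

lemma pos_semidef_matrix_inv:
  fixes M :: "real^'m^'m"
  assumes "invertible M" "pos_semidef M"
  shows "pos_semidef (matrix_inv M)"
proof -
  have "u \<bullet> (matrix_inv M *v u) = (matrix_inv M *v u) \<bullet> (M *v (matrix_inv M *v u))" for u
    using matrix_inv_mult(1)[OF assms(1)] by (simp add: matrix_vector_mul_assoc inner_commute)
  then show ?thesis
    using assms by (auto simp: pos_semidef_def symmetric_matrix_inv)
qed

lemma sum_over_blocks:
  fixes blk :: "'c::finite \<Rightarrow> 'k::finite"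
  shows "(\<Sum>l\<in>UNIV. \<Sum>c\<in>{c. blk c = l}. h c) = (\<Sum>c\<in>UNIV. h c)"
  using sum.group[of "UNIV::'c set" "UNIV::'k set" blk h] by simp

lemma Nmat_mult_vector:
  "Nmat B blk w *v v = (\<Sum>c\<in>UNIV. (w (blk c) * (column c B \<bullet> v)) *\<^sub>R column c B)"
proof -
  have "Nmat B blk w *v v
      = (\<Sum>l\<in>UNIV. \<Sum>c\<in>{c. blk c = l}. (w (blk c) * (column c B \<bullet> v)) *\<^sub>R column c B)"
    unfolding Nmat_def
    by (auto simp: sum_matrix_vector outer_mult_vector scaleR_sum_right
        simp flip: scaleR_matrix_vector_assoc intro!: sum.cong)
  also have "\<dots> = (\<Sum>c\<in>UNIV. (w (blk c) * (column c B \<bullet> v)) *\<^sub>R column c B)"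
    by (rule sum_over_blocks)
  finally show ?thesis .
qed

lemma inner_Nmat:
  "u \<bullet> (Nmat B blk w *v v) = (\<Sum>c\<in>UNIV. w (blk c) * (column c B \<bullet> u) * (column c B \<bullet> v))"
  by (simp add: Nmat_mult_vector inner_sum_right inner_commute mult_ac)

lemma symmetric_Nmat: "transpose (Nmat B blk w) = Nmat B blk w"
  by (rule symmetric_matrixI) (simp add: inner_Nmat inner_commute mult_ac)

lemma block_bound_nonneg:
  fixes S :: "real^'m^'m" and B :: "real^'c::finite^'m"
  assumes "pos_semidef S" "\<And>l. (\<Sum>c\<in>{c. blk c = l}. column c B \<bullet> (S *v column c B)) \<le> \<alpha>"
  shows "0 \<le> \<alpha>"
proof -
  have "0 \<le> (\<Sum>c\<in>{c. blk c = undefined}. column c B \<bullet> (S *v column c B))"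
    using assms(1) by (intro sum_nonneg) (simp add: pos_semidef_def)
  then show ?thesis
    using assms(2)[of undefined] by linarith
qed

lemma weighted_block_sum_le:
  fixes S :: "real^'m^'m" and B :: "real^'c::finite^'m" and blk :: "'c \<Rightarrow> 'k::finite"
  assumes "\<And>l. (\<Sum>c\<in>{c. blk c = l}. column c B \<bullet> (S *v column c B)) \<le> \<alpha>" "weight w"
  shows "(\<Sum>c\<in>UNIV. w (blk c) * (column c B \<bullet> (S *v column c B))) \<le> \<alpha>"
proof -
  have "(\<Sum>c\<in>UNIV. w (blk c) * (column c B \<bullet> (S *v column c B)))
      = (\<Sum>l\<in>UNIV. \<Sum>c\<in>{c. blk c = l}. w (blk c) * (column c B \<bullet> (S *v column c B)))"
    by (rule sum_over_blocks[symmetric])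
  also have "\<dots> = (\<Sum>l\<in>UNIV. w l * (\<Sum>c\<in>{c. blk c = l}. column c B \<bullet> (S *v column c B)))"
    unfolding sum_distrib_left by (intro sum.cong) auto
  also have "\<dots> \<le> (\<Sum>l\<in>UNIV. w l * \<alpha>)"
    using assms unfolding weight_def by (intro sum_mono mult_left_mono) auto
  also have "\<dots> = \<alpha>"
    using assms(2) by (simp add: weight_def flip: sum_distrib_right)
  finally show ?thesis .
qed

lemma weighted_Cauchy_Schwarz:
  fixes W a d :: "'c \<Rightarrow> real"
  assumes "\<And>c. 0 \<le> W c"
  shows "(\<Sum>c\<in>A. W c * a c * d c)\<^sup>2 \<le> (\<Sum>c\<in>A. W c * (a c)\<^sup>2) * (\<Sum>c\<in>A. W c * (d c)\<^sup>2)"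
proof -
  have "(\<Sum>c\<in>A. W c * a c * d c) = (\<Sum>c\<in>A. (sqrt (W c) * a c) * (sqrt (W c) * d c))"
    using assms by (intro sum.cong) (auto simp: algebra_simps simp flip: real_sqrt_mult)
  then show ?thesis
    using Cauchy_Schwarz_ineq_sum[of "\<lambda>c. sqrt (W c) * a c" "\<lambda>c. sqrt (W c) * d c" A] assms
    by (simp add: power_mult_distrib)
qed

lemma quadratic_form_le_Nmat_ginverse:
  fixes S :: "real^'m^'m" and B :: "real^'c::finite^'m" and blk :: "'c \<Rightarrow> 'k::finite"
  assumes S: "pos_semidef S"
    and tr: "\<And>l. (\<Sum>c\<in>{c. blk c = l}. column c B \<bullet> (S *v column c B)) \<le> \<alpha>"
    and w: "weight w" and e: "e \<in> range ((*v) (Nmat B blk w))"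
    and X: "Nmat B blk w ** X ** Nmat B blk w = Nmat B blk w"
  shows "e \<bullet> (S *v e) \<le> \<alpha> * (e \<bullet> (X *v e))"
proof -
  define W b where "W c = w (blk c)" and "b c = column c B" for c
  define x where "x = X *v e"
  define a d where "a c = b c \<bullet> x" and "d c = b c \<bullet> (S *v e)" for c
  define q where "q = e \<bullet> (S *v e)"
  have W: "0 \<le> W c" for c
    using w by (simp add: W_def weight_def)
  have Nx: "Nmat B blk w *v x = e"
    using e X by (auto simp: x_def matrix_vector_mul_assoc)
  have q: "q = (\<Sum>c\<in>UNIV. W c * a c * d c)"
    using inner_Nmat[of "S *v e" B blk w x]
    by (simp add: q_def Nx W_def a_def d_def b_def inner_commute mult_ac)
  have xe: "x \<bullet> e = (\<Sum>c\<in>UNIV. W c * (a c)\<^sup>2)"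
    using inner_Nmat[of x B blk w x] by (simp add: Nx W_def a_def b_def power2_eq_square mult_ac)
  have "0 \<le> x \<bullet> e"
    unfolding xe using W by (simp add: sum_nonneg)
  have "0 \<le> q"
    using S by (simp add: q_def pos_semidef_def)
  have "(\<Sum>c\<in>UNIV. W c * (d c)\<^sup>2) \<le> (\<Sum>c\<in>UNIV. W c * ((b c \<bullet> (S *v b c)) * q))"
    using W pos_semidef_inner_square_le[OF S] by (intro sum_mono mult_left_mono) (auto simp: d_def q_def)
  also have "\<dots> = (\<Sum>c\<in>UNIV. W c * (b c \<bullet> (S *v b c))) * q"
    by (simp add: sum_distrib_right mult.assoc)
  also have "\<dots> \<le> \<alpha> * q"
    using weighted_block_sum_le[OF tr w] \<open>0 \<le> q\<close> by (simp add: W_def b_def mult_right_mono)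
  finally have "q\<^sup>2 \<le> (x \<bullet> e) * (\<alpha> * q)"
    using weighted_Cauchy_Schwarz[OF W, where A=UNIV and a=a and d=d] mult_left_mono[OF _ \<open>0 \<le> x \<bullet> e\<close>]
    unfolding q xe by (meson order_trans)
  then have "q \<le> \<alpha> * (x \<bullet> e)"
    using \<open>0 \<le> q\<close> \<open>0 \<le> x \<bullet> e\<close> block_bound_nonneg[OF S tr]
    by (cases "q = 0") (auto simp: power2_eq_square algebra_simps)
  then show ?thesis
    by (simp add: q_def x_def inner_commute)
qed

lemma diag_le_pinv_Nmat:
  fixes S :: "real^'m^'m" and B :: "real^'c::finite^'m" and blk :: "'c \<Rightarrow> 'k::finite"
  assumes "pos_semidef S"
    and "\<And>l. (\<Sum>c\<in>{c. blk c = l}. column c B \<bullet> (S *v column c B)) \<le> \<alpha>"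
    and "weight w" "axis j 1 \<in> range ((*v) (Nmat B blk w))"
  shows "S $ j $ j \<le> \<alpha> * pinv (Nmat B blk w) $ j $ j"
  using quadratic_form_le_Nmat_ginverse[OF assms]
    penrose_pinv_symmetric[OF symmetric_Nmat, of B blk w]
  by (simp add: penrose_def inner_axis_mult_axis)

lemma mult_transpose_mult_vector:
  fixes B :: "real^'c::finite^'m"
  shows "(B ** transpose B) *v v = (\<Sum>c\<in>UNIV. (column c B \<bullet> v) *\<^sub>R column c B)"
proof -
  have "(transpose B *v v) $ c = column c B \<bullet> v" for c
    by (simp add: vector_matrix_mult_def column_def inner_vec_def mult.commute)
  then show ?thesis
    by (simp add: matrix_mult_sum[of B] scalar_mult_eq_scaleR flip: matrix_vector_mul_assoc)
qed

lemma invertible_mult_transpose: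
  fixes B :: "real^'c::finite^'m"
  assumes "range ((*v) B) = UNIV"
  shows "invertible (B ** transpose B)"
proof (rule invertible_if_inj)
  fix z assume "(B ** transpose B) *v z = 0"
  then have "B *v (transpose B *v z) = 0"
    by (metis matrix_vector_mul_assoc)
  then have "(transpose B *v z) \<bullet> (transpose B *v z) = 0"
    by (metis dot_lmul_matrix inner_zero_right transpose_matrix_vector)
  then have "z \<bullet> (B *v t) = 0" for t
    using dot_lmul_matrix[of z B t] by simp
  moreover obtain t where "z = B *v t"
    using assms by (metis UNIV_I image_iff)
  ultimately show "z = 0" by (metis inner_eq_zero_iff)
qed

lemma mult_pinv_right_invertible:
  fixes B :: "real^'c::finite^'m"
  assumes "range ((*v) B) = UNIV"
  shows "B ** pinv B = mat 1"
proof -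
  define G where "G = B ** transpose B"
  have "invertible G" "transpose G = G"
    using invertible_mult_transpose[OF assms] by (simp_all add: G_def matrix_transpose_mul)
  then have G: "G ** matrix_inv G = mat 1" "transpose (matrix_inv G) = matrix_inv G"
    by (simp_all add: matrix_inv_mult symmetric_matrix_inv)
  define P where "P = transpose B ** matrix_inv G"
  have BP: "B ** P = mat 1"
    using G by (simp add: P_def G_def matrix_mul_assoc)
  have "P ** B ** P = P"
    by (metis BP matrix_mul_assoc matrix_mul_rid)
  then have "penrose B P"
    unfolding penrose_def
    using BP G(2) by (simp add: P_def matrix_transpose_mul matrix_mul_assoc)
  with BP show ?thesis
    by (simp add: pinv_eqI)
qed

lemma diag_le_uniform_weight:
  fixes S :: "real^'m^'m" and B :: "real^'c::finite^'m" and blk :: "'c \<Rightarrow> 'k::finite"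
  assumes S: "pos_semidef S"
    and tr: "\<And>l. (\<Sum>c\<in>{c. blk c = l}. column c B \<bullet> (S *v column c B)) \<le> \<alpha>"
    and B: "range ((*v) B) = UNIV"
  shows "S $ j $ j \<le> \<alpha> * (real CARD('k) * matrix_inv (B ** transpose B) $ j $ j)"
proof -
  define K where "K = real CARD('k)"
  define G where "G = B ** transpose B"
  define X where "X = K *\<^sub>R matrix_inv G"
  define u where "u = (\<lambda>l::'k. 1 / K)"
  have "weight u"
    by (simp add: weight_def u_def K_def)
  have Nu: "Nmat B blk u *v v = (1 / K) *\<^sub>R (G *v v)" for v
    by (simp add: Nmat_mult_vector G_def u_def mult_transpose_mult_vector scaleR_sum_right)
  have NX: "Nmat B blk u *v (X *v v) = v" for v
  proof -
    have "Nmat B blk u *v (X *v v) = G *v (matrix_inv G *v v)"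
      by (simp add: Nu X_def K_def matrix_scaleR_vector_ac flip: scaleR_matrix_vector_assoc)
    also have "\<dots> = v"
      using matrix_inv_mult(1)[OF invertible_mult_transpose[OF B]]
      by (simp add: G_def matrix_vector_mul_assoc)
    finally show ?thesis .
  qed
  have ginv: "Nmat B blk u ** X ** Nmat B blk u = Nmat B blk u"
    by (simp add: matrix_eq NX flip: matrix_vector_mul_assoc)
  have "axis j 1 \<in> range ((*v) (Nmat B blk u))"
    using NX by (metis rangeI)
  from quadratic_form_le_Nmat_ginverse[OF S tr \<open>weight u\<close> this ginv]
  show ?thesis
    by (simp add: inner_axis_mult_axis X_def K_def G_def)
qed

lemma in_range_Nmat_if_support:
  fixes B :: "real^'c::finite^'m" and blk :: "'c \<Rightarrow> 'k::finite"
  assumes w: "weight w" and h: "B *v h = e" and supp: "\<And>c. h $ c \<noteq> 0 \<Longrightarrow> 0 < w (blk c)"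
  shows "e \<in> range ((*v) (Nmat B blk w))"
proof (rule in_range_symmetric_matrixI[OF symmetric_Nmat])
  fix z assume "Nmat B blk w *v z = 0"
  then have "(\<Sum>c\<in>UNIV. w (blk c) * (column c B \<bullet> z) * (column c B \<bullet> z)) = 0"
    using inner_Nmat[of z B blk w z] by simp
  moreover have "0 \<le> w (blk c) * (column c B \<bullet> z) * (column c B \<bullet> z)" for c
    using w by (simp add: weight_def mult.assoc)
  ultimately have terms: "w (blk c) * (column c B \<bullet> z) * (column c B \<bullet> z) = 0" for c
    by (simp add: sum_nonneg_eq_0_iff)
  have summand: "h $ c * (column c B \<bullet> z) = 0" for c
  proof (cases "h $ c = 0")
    case False
    with supp[of c] terms[of c] show ?thesis by simp
  qed simp
  have "e \<bullet> z = (\<Sum>c\<in>UNIV. h $ c * (column c B \<bullet> z))"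
    using h by (auto simp: matrix_mult_sum scalar_mult_eq_scaleR inner_sum_left)
  then show "e \<bullet> z = 0"
    by (simp only: summand sum.neutral_const)
qed

lemma w_plus_weight_support:
  fixes B :: "real^'c::finite^'m" and blk :: "'c \<Rightarrow> 'k::finite"
  assumes "pinv B *v axis j 1 \<noteq> 0"
  shows "weight (w_plus B blk j)"
    and "\<And>c. (pinv B *v axis j 1) $ c \<noteq> 0 \<Longrightarrow> 0 < w_plus B blk j (blk c)"
proof -
  define h where "h = pinv B *v axis j 1"
  define T where "T = (\<Sum>t\<in>UNIV. hnorm B blk j t)"
  have nonneg: "0 \<le> hnorm B blk j l" for l
    by (simp add: hnorm_def sum_nonneg)
  have pos: "0 < hnorm B blk j (blk c)" if "h $ c \<noteq> 0" for c
  proof -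
    have "0 < (h $ c)\<^sup>2"
      using that by simp
    also have "(h $ c)\<^sup>2 \<le> (\<Sum>c'\<in>{c'. blk c' = blk c}. (h $ c')\<^sup>2)"
      by (rule member_le_sum) auto
    finally show ?thesis
      by (simp add: hnorm_def h_def)
  qed
  obtain c where "h $ c \<noteq> 0"
    using assms by (auto simp: h_def vec_eq_iff)
  then have "0 < T"
    unfolding T_def using pos nonneg by (intro sum_pos2) auto
  then show "weight (w_plus B blk j)"
    by (simp add: weight_def w_plus_def nonneg flip: T_def sum_divide_distrib)
  show "0 < w_plus B blk j (blk c)" if "(pinv B *v axis j 1) $ c \<noteq> 0" for c
    using pos[of c] that \<open>0 < T\<close> by (simp add: w_plus_def h_def flip: T_def)
qed

lemma w_plus_in_range_Nmat:
  fixes B :: "real^'c::finite^'m" and blk :: "'c \<Rightarrow> 'k::finite"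
  assumes "range ((*v) B) = UNIV"
  shows "weight (w_plus B blk j)" and "axis j 1 \<in> range ((*v) (Nmat B blk (w_plus B blk j)))"
proof -
  have Bh: "B *v (pinv B *v axis j 1) = axis j 1"
    using mult_pinv_right_invertible[OF assms] by (simp add: matrix_vector_mul_assoc)
  then have "pinv B *v axis j 1 \<noteq> 0"
    by (metis axis_eq_0_iff matrix_vector_mult_0_right zero_neq_one)
  then show "weight (w_plus B blk j)" "axis j 1 \<in> range ((*v) (Nmat B blk (w_plus B blk j)))"
    using in_range_Nmat_if_support[OF _ Bh] w_plus_weight_support by blast+
qed

lemma block_sum_le_Phi_of_optimal:
  assumes "Phi_optimal B blk f N d" "is_design N d0" "invertible (info_mat f d0)"
  shows "(\<Sum>c\<in>{c. blk c = l}. column c B \<bullet> (matrix_inv (info_mat f d) *v column c B))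
    \<le> Phi B blk (info_mat f d0)"
proof -
  have "block_trace B blk l (info_mat f d) \<le> Phi B blk (info_mat f d)"
    unfolding Phi_def by (rule Max_ge) auto
  also have "\<dots> \<le> Phi B blk (info_mat f d0)"
    using assms by (simp add: Phi_optimal_def)
  finally show ?thesis
    by (simp add: block_trace_def)
qed

theorem theorem1:
  fixes f :: "'n::finite \<Rightarrow> real^'m::finite"
    and B :: "real^'c::finite^'m"
    and blk :: "'c \<Rightarrow> 'k::finite"
    and N :: nat
    and d0 dstar :: "'n \<Rightarrow> bool"
    and j k :: 'm
    and wj wk :: "'k \<Rightarrow> real"
  assumes "2 \<le> CARD('m)" "CARD('m) \<le> N" "N \<le> CARD('n)"
    and "span (range f) = UNIV"
    and "surj blk"
    and "range ((*v) B) = UNIV"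
    and "\<forall>c. column c B \<noteq> 0"
    and "is_design N d0" "invertible (info_mat f d0)"
    and "Phi_optimal B blk f N dstar"
    and "is_w_star B blk j wj" "is_w_star B blk k wk"
  shows "\<bar>matrix_inv (info_mat f dstar) $ j $ k\<bar>
        \<le> Phi B blk (info_mat f d0) * real CARD('k) *
           sqrt (matrix_inv (B ** transpose B) $ j $ j * matrix_inv (B ** transpose B) $ k $ k)
    \<and> \<bar>matrix_inv (info_mat f dstar) $ j $ k\<bar>
        \<le> Phi B blk (info_mat f d0) *
           sqrt (pinv (Nmat B blk (w_plus B blk j)) $ j $ j * pinv (Nmat B blk (w_plus B blk k)) $ k $ k)
    \<and> \<bar>matrix_inv (info_mat f dstar) $ j $ k\<bar>
        \<le> Phi B blk (info_mat f d0) *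
           sqrt (pinv (Nmat B blk wj) $ j $ j * pinv (Nmat B blk wk) $ k $ k)"
proof -
  define S where "S = matrix_inv (info_mat f dstar)"
  define \<alpha> where "\<alpha> = Phi B blk (info_mat f d0)"
  have S: "pos_semidef S"
    unfolding S_def using assms(10)
    by (intro pos_semidef_matrix_inv pos_semidef_info_mat) (simp add: Phi_optimal_def)
  have tr: "\<And>l. (\<Sum>c\<in>{c. blk c = l}. column c B \<bullet> (S *v column c B)) \<le> \<alpha>"
    using block_sum_le_Phi_of_optimal[OF assms(10,8,9)] by (simp add: S_def \<alpha>_def)
  note entry_le = pos_semidef_entry_abs_le[OF S block_bound_nonneg[OF S tr]]
  define K where "K = real CARD('k)"
  define G where "G = matrix_inv (B ** transpose B)"
  have "\<bar>S $ j $ k\<bar> \<le> \<alpha> * sqrt ((K * G $ j $ j) * (K * G $ k $ k))"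
    using entry_le diag_le_uniform_weight[OF S tr assms(6)] by (simp add: K_def G_def)
  also have "(K * G $ j $ j) * (K * G $ k $ k) = K\<^sup>2 * (G $ j $ j * G $ k $ k)"
    by (simp add: power2_eq_square mult_ac)
  finally have uniform: "\<bar>S $ j $ k\<bar> \<le> \<alpha> * K * sqrt (G $ j $ j * G $ k $ k)"
    by (simp add: real_sqrt_mult K_def mult.assoc)
  have w_plus: "\<bar>S $ j $ k\<bar> \<le>
      \<alpha> * sqrt (pinv (Nmat B blk (w_plus B blk j)) $ j $ j * pinv (Nmat B blk (w_plus B blk k)) $ k $ k)"
    using entry_le diag_le_pinv_Nmat[OF S tr w_plus_in_range_Nmat[OF assms(6)]] by blast
  have w_star: "\<bar>S $ j $ k\<bar> \<le> \<alpha> * sqrt (pinv (Nmat B blk wj) $ j $ j * pinv (Nmat B blk wk) $ k $ k)"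
    using entry_le diag_le_pinv_Nmat[OF S tr] assms(11,12) by (simp add: is_w_star_def)
  show ?thesis
    using uniform w_plus w_star by (simp add: S_def \<alpha>_def K_def G_def)
qed

end
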